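(* Let $\alpha>-1$, let $n\in\mathbb{N}$, and let $\mu,\eta\in\mathbb{C}$ with $|\mu|=|\eta|=1$. Let $\phi$ be an analytic self-map of $\mathbb{D}$ with $\phi(0)=0$, and let $\psi$ be an analytic function on $\mathbb{D}$, not identically zero, such that the operator $D_{n,\psi,\phi}$ is bounded and complex symmetric on $\mathcal{A}^2_\alpha$ with conjugation $C_{\mu,\eta}$. Then $D_{n,\psi,\phi}$ is normal.
   Context: $\mathbb{D}=\{z\in\mathbb{C}:|z|<1\}$ and $\mathbb{N}=\{1,2,3,\dots\}$. For $-1<\alpha<\infty$, the weighted Bergman space $\mathcal{A}^2_\alpha$ is the Hilbert space of analytic functions $f$ on $\mathbb{D}$ with $\|f\|^2=\int_{\mathbb{D}}|f(z)|^2(\alpha+1)(1-|z|^2)^\alpha\,dA(z)<\infty$, where $dA$ is the normalized area measure on $\mathbb{D}$ (total mass 1). The weighted composition-differentiation operator is $(D_{n,\psi,\phi}f)(z)=\psi(z)f^{(n)}(\phi(z))$, where $f^{(n)}$ is the $n$-th derivative. "Bounded on $\mathcal{A}^2_\alpha$" means that it defines a bounded linear operator from $\mathcal{A}^2_\alpha$ to itself. The conjugation $C_{\mu,\eta}$ is the antilinear map $(C_{\mu,\eta}f)(z)=\mu\,\overline{f(\overline{\eta z})}$. A bounded operator $T$ is complex symmetric with conjugation $C_{\mu,\eta}$ if $T=C_{\mu,\eta}T^*C_{\mu,\eta}$. A bounded operator $T$ is normal if $TT^*=T^*T$. *)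

theory Defs
  imports "HOL-Complex_Analysis.Complex_Analysis"
begin

abbreviation unit_disk :: "complex set" where
  "unit_disk \<equiv> ball 0 1"

text \<open>The measure with density \<open>(\<alpha> + 1) (1 - |z|\<^sup>2)\<^sup>\<alpha>\<close> on the disk with respect to the
  normalized area measure, which is Lebesgue measure on the disk divided by \<open>\<pi>\<close>.\<close>

definition bergman_measure :: "real \<Rightarrow> complex measure" where
  "bergman_measure \<alpha> = density lborel
     (\<lambda>z. indicator unit_disk z * ennreal ((\<alpha> + 1) * (1 - (cmod z)\<^sup>2) powr \<alpha> / pi))"

text \<open>A function on the disk is represented by its extension by zero to the whole plane, so that
  equality of elements of the space is equality of functions.\<close>

definition bergman_space :: "real \<Rightarrow> (complex \<Rightarrow> complex) set" where
  "bergman_space \<alpha> = {f. f holomorphic_on unit_disk \<and> (\<forall>z. z \<notin> unit_disk \<longrightarrow> f z = 0) \<and>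
     integrable (bergman_measure \<alpha>) (\<lambda>z. (cmod (f z))\<^sup>2)}"

definition bergman_inner :: "real \<Rightarrow> (complex \<Rightarrow> complex) \<Rightarrow> (complex \<Rightarrow> complex) \<Rightarrow> complex" where
  "bergman_inner \<alpha> f g = (LINT z|bergman_measure \<alpha>. f z * cnj (g z))"

definition bergman_norm :: "real \<Rightarrow> (complex \<Rightarrow> complex) \<Rightarrow> real" where
  "bergman_norm \<alpha> f = sqrt (LINT z|bergman_measure \<alpha>. (cmod (f z))\<^sup>2)"

type_synonym operator = "(complex \<Rightarrow> complex) \<Rightarrow> (complex \<Rightarrow> complex)"

definition bounded_operator :: "real \<Rightarrow> operator \<Rightarrow> bool" where
  "bounded_operator \<alpha> T \<longleftrightarrow>
     (\<forall>f\<in>bergman_space \<alpha>. T f \<in> bergman_space \<alpha>) \<and>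
     (\<forall>f\<in>bergman_space \<alpha>. \<forall>g\<in>bergman_space \<alpha>. T (\<lambda>z. f z + g z) = (\<lambda>z. T f z + T g z)) \<and>
     (\<forall>f\<in>bergman_space \<alpha>. \<forall>c. T (\<lambda>z. c * f z) = (\<lambda>z. c * T f z)) \<and>
     (\<exists>K. \<forall>f\<in>bergman_space \<alpha>. bergman_norm \<alpha> (T f) \<le> K * bergman_norm \<alpha> f)"

text \<open>The Hilbert space adjoint. For a bounded operator \<open>T\<close> and \<open>g\<close> in the space, the element
  described here exists and is unique by the Riesz representation theorem. Values at \<open>g\<close> outside
  the space are irrelevant.\<close>

definition hilbert_adjoint :: "real \<Rightarrow> operator \<Rightarrow> operator" where
  "hilbert_adjoint \<alpha> T g = (THE h. h \<in> bergman_space \<alpha> \<and>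
     (\<forall>f\<in>bergman_space \<alpha>. bergman_inner \<alpha> (T f) g = bergman_inner \<alpha> f h))"

definition weighted_comp_diff :: "nat \<Rightarrow> (complex \<Rightarrow> complex) \<Rightarrow> (complex \<Rightarrow> complex) \<Rightarrow> operator" where
  "weighted_comp_diff n \<psi> \<phi> f =
     (\<lambda>z. if z \<in> unit_disk then \<psi> z * (deriv ^^ n) f (\<phi> z) else 0)"

definition conjugation :: "complex \<Rightarrow> complex \<Rightarrow> operator" where
  "conjugation \<mu> \<eta> f = (\<lambda>z. \<mu> * cnj (f (cnj (\<eta> * z))))"

definition complex_symmetric :: "real \<Rightarrow> operator \<Rightarrow> operator \<Rightarrow> bool" where
  "complex_symmetric \<alpha> C T \<longleftrightarrow> bounded_operator \<alpha> T \<and>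
     (\<forall>f\<in>bergman_space \<alpha>. T f = C (hilbert_adjoint \<alpha> T (C f)))"

definition normal_operator :: "real \<Rightarrow> operator \<Rightarrow> bool" where
  "normal_operator \<alpha> T \<longleftrightarrow> bounded_operator \<alpha> T \<and>
     (\<forall>f\<in>bergman_space \<alpha>. T (hilbert_adjoint \<alpha> T f) = hilbert_adjoint \<alpha> T (T f))"

end

theory Submission
  imports Defs
begin

text \<open>
  Complex symmetry and \<open>\<phi> 0 = 0\<close> together force the operator \<open>T\<close> to be diagonal in the orthogonal
  basis of monomials \<open>e\<^sub>k = z\<^sup>k\<close>, and diagonal operators are normal.

  Since \<open>C\<close> multiplies \<open>e\<^sub>k\<close> by a unimodular constant, \<open>T = C T\<^sup>* C\<close> says that the matrix of \<open>T\<close> is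
  symmetric up to unimodular factors; in particular its zero pattern is symmetric. Differentiating
  \<open>n\<close> times kills \<open>e\<^sub>k\<close> for \<open>k < n\<close>. By symmetry no image under \<open>T\<close> has terms of degree below \<open>n\<close>, and
  as \<open>T e\<^sub>n = n! \<psi>\<close>, the weight \<open>\<psi>\<close> vanishes at 0 to order \<open>n\<close>. Because \<open>\<phi> 0 = 0\<close>, the function \<open>T e\<^sub>k\<close>,
  a multiple of \<open>\<psi>\<close> times the power \<open>k - n\<close> of \<open>\<phi>\<close>, vanishes to order \<open>n + (k - n) = k\<close>. So the matrix
  is triangular, and by symmetry diagonal.

  To make this precise, inner products have to be read off from Taylor coefficients. The
  measure is finite (\<open>finite_measure_bergman\<close>), so polynomials lie in the space. It is invariant
  under rotations, so monomials are orthogonal (\<open>truncated_inner_disk_power_orthogonal\<close>).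
  Integrating power series over disks of radius \<open>r < 1\<close> and letting \<open>r\<close> tend to 1 gives the
  cases of Parseval's identity that are used (\<open>bergman_inner_eqI\<close>, \<open>bergman_inner_finite\<close>). The
  values of the adjoint that occur are written down explicitly: at monomials they are polynomials,
  because the \<open>j\<close>-th coefficient of \<open>T f\<close> depends only on the coefficients of \<open>f\<close> up to \<open>j + n\<close>
  (\<open>taylor_coeff_weighted_comp_diff\<close>), and for a diagonal operator the adjoint is obtained by
  conjugating with \<open>f \<mapsto> cnj \<circ> f \<circ> cnj\<close> (\<open>normal_if_diagonal\<close>).
\<close>

section \<open>Rotation invariance of Lebesgue measure on the plane\<close>

lemma borel_measurable_Complex_pair [measurable]:
  "(\<lambda>p. Complex (fst p) (snd p)) \<in> borel_measurable (lborel \<Otimes>\<^sub>M lborel)"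
proof -
  have "continuous_on UNIV (\<lambda>p. Complex (fst p) (snd p))"
    unfolding Complex_eq by (intro continuous_intros)
  from borel_measurable_continuous_onI[OF this] show ?thesis by (simp add: lborel_prod)
qed

lemma lborel_complex:
  "distr (lborel \<Otimes>\<^sub>M lborel) borel (\<lambda>p. Complex (fst p) (snd p)) = lborel"
proof (rule lborel_eqI[symmetric])
  fix l u :: complex
  assume le: "\<And>b. b \<in> Basis \<Longrightarrow> l \<bullet> b \<le> u \<bullet> b"
  have "(\<lambda>p. Complex (fst p) (snd p)) -` box l u \<inter> space (lborel \<Otimes>\<^sub>M lborel)
      = box (Re l) (Re u) \<times> box (Im l) (Im u)"
    by (auto simp: box_def Basis_complex_def space_pair_measure)
  moreover have "Re l \<le> Re u" "Im l \<le> Im u"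
    using le[of 1] le[of \<i>] by (auto simp: Basis_complex_def)
  ultimately show "emeasure (distr (lborel \<Otimes>\<^sub>M lborel) borel (\<lambda>p. Complex (fst p) (snd p))) (box l u)
      = (\<Prod>b\<in>Basis. (u - l) \<bullet> b)"
    by (simp add: emeasure_distr lborel.emeasure_pair_measure_Times Basis_complex_def ennreal_mult)
qed simp

lemma nn_integral_lborel_complex:
  assumes [measurable]: "f \<in> borel_measurable (borel :: complex measure)"
  shows "(\<integral>\<^sup>+ z. f z \<partial>lborel) = (\<integral>\<^sup>+ y. \<integral>\<^sup>+ x. f (Complex x y) \<partial>lborel \<partial>lborel)"
    and "(\<integral>\<^sup>+ z. f z \<partial>lborel) = (\<integral>\<^sup>+ x. \<integral>\<^sup>+ y. f (Complex x y) \<partial>lborel \<partial>lborel)"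
proof -
  have "(\<integral>\<^sup>+ z. f z \<partial>lborel) = (\<integral>\<^sup>+ p. f (Complex (fst p) (snd p)) \<partial>(lborel \<Otimes>\<^sub>M lborel))"
    by (subst lborel_complex[symmetric], subst nn_integral_distr) auto
  moreover have m2: "(\<lambda>p. f (Complex (fst p) (snd p))) \<in> borel_measurable (lborel \<Otimes>\<^sub>M lborel)"
    by measurable
  ultimately show "(\<integral>\<^sup>+ z. f z \<partial>lborel) = (\<integral>\<^sup>+ y. \<integral>\<^sup>+ x. f (Complex x y) \<partial>lborel \<partial>lborel)"
    and "(\<integral>\<^sup>+ z. f z \<partial>lborel) = (\<integral>\<^sup>+ x. \<integral>\<^sup>+ y. f (Complex x y) \<partial>lborel \<partial>lborel)"
    using lborel_pair.nn_integral_snd[of "\<lambda>p. f (Complex (fst p) (snd p))"]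
      lborel.nn_integral_fst[OF m2] by auto
qed

text \<open>Fubini reduces a shear to a translation of the real line in the coordinate that it moves.\<close>

lemma nn_integral_shear:
  assumes [measurable]: "f \<in> borel_measurable (borel :: complex measure)"
  shows "(\<integral>\<^sup>+ z. f (z + of_real (t * Im z)) \<partial>lborel) = (\<integral>\<^sup>+ z. f z \<partial>lborel)"
    and "(\<integral>\<^sup>+ z. f (z + \<i> * of_real (t * Re z)) \<partial>lborel) = (\<integral>\<^sup>+ z. f z \<partial>lborel)"
proof -
  have m: "(\<lambda>x. f (Complex x y)) \<in> borel_measurable lborel"
      "(\<lambda>x. f (Complex y x)) \<in> borel_measurable lborel" for y
  proof -
    have "continuous_on UNIV (\<lambda>x. Complex x y)" "continuous_on UNIV (\<lambda>x. Complex y x)"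
      unfolding Complex_eq by (intro continuous_intros)+
    from this[THEN borel_measurable_continuous_onI]
    have [measurable]: "(\<lambda>x. Complex x y) \<in> borel_measurable borel"
      "(\<lambda>x. Complex y x) \<in> borel_measurable borel" .
    show "(\<lambda>x. f (Complex x y)) \<in> borel_measurable lborel"
      "(\<lambda>x. f (Complex y x)) \<in> borel_measurable lborel" by measurable
  qed
  have e: "Complex x y + of_real (t * Im (Complex x y)) = Complex (t * y + 1 * x) y"
     "Complex x y + \<i> * of_real (t * Re (Complex x y)) = Complex x (t * x + 1 * y)" for x y
    by (auto simp: complex_eq_iff)
  show "(\<integral>\<^sup>+ z. f (z + of_real (t * Im z)) \<partial>lborel) = (\<integral>\<^sup>+ z. f z \<partial>lborel)"
    by (subst (1 2) nn_integral_lborel_complex(1), simp, simp)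
      (simp only: e, rule nn_integral_cong,
       use m in \<open>subst (2) nn_integral_real_affine[where c = 1]; simp\<close>)
  show "(\<integral>\<^sup>+ z. f (z + \<i> * of_real (t * Re z)) \<partial>lborel) = (\<integral>\<^sup>+ z. f z \<partial>lborel)"
    by (subst (1 2) nn_integral_lborel_complex(2), simp, simp)
      (simp only: e, rule nn_integral_cong,
       use m in \<open>subst (2) nn_integral_real_affine[where c = 1]; simp\<close>)
qed

text \<open>A rotation is a product of three shears: with \<open>\<omega> = a + \<i> b\<close>, \<open>a\<^sup>2 + b\<^sup>2 = 1\<close> and \<open>b \<noteq> 0\<close>,
  it is the horizontal shear by \<open>s = (a - 1) / b\<close>, then the vertical shear by \<open>b\<close>, then the
  horizontal shear by \<open>s\<close> again. This explains the hypothesis \<open>Im \<omega> \<noteq> 0\<close>.\<close>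

lemma lborel_rotation:
  assumes "cmod \<omega> = 1" "Im \<omega> \<noteq> 0"
  shows "distr lborel borel ((*) \<omega>) = lborel"
proof (rule measure_eqI)
  fix A assume "A \<in> sets (distr lborel borel ((*) \<omega>))"
  then have A [measurable]: "A \<in> sets borel" by simp
  define f :: "complex \<Rightarrow> ennreal" where "f = indicator A"
  have f [measurable]: "f \<in> borel_measurable borel" unfolding f_def by simp
  define s where "s = (Re \<omega> - 1) / Im \<omega>"
  have sq: "(Re \<omega>)\<^sup>2 + (Im \<omega>)\<^sup>2 = 1" using assms(1) by (simp add: cmod_def)
  define H V where "H = (\<lambda>z. z + of_real (s * Im z))" and "V = (\<lambda>z. z + \<i> * of_real (Im \<omega> * Re z))"
  have [measurable]: "H \<in> borel_measurable borel" "V \<in> borel_measurable borel"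
    unfolding H_def V_def by (intro borel_measurable_continuous_onI continuous_intros)+
  have eq: "\<omega> * z = H (V (H z))" for z
  proof (rule complex_eqI)
    have a: "s * Im \<omega> = Re \<omega> - 1" using assms(2) by (simp add: s_def)
    have "Im \<omega> * (s + (s * Im \<omega>) * s + s) = (s * Im \<omega>) * 2 + (s * Im \<omega>) * (s * Im \<omega>)"
      by (simp add: algebra_simps)
    also have "\<dots> = Im \<omega> * (- Im \<omega>)" 
      unfolding a using sq by (simp add: algebra_simps power2_eq_square)
    finally have b: "s + (s * Im \<omega>) * s + s = - Im \<omega>" using assms(2) mult_left_cancel by blast
    have "Re (H (V (H z))) = Re z * (1 + s * Im \<omega>) + Im z * (s + (s * Im \<omega>) * s + s)"
      unfolding H_def V_def by (simp add: algebra_simps)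
    also have "\<dots> = Re (\<omega> * z)" unfolding b unfolding a by (simp add: algebra_simps)
    finally show "Re (\<omega> * z) = Re (H (V (H z)))" ..
    have "Im (H (V (H z))) = Im z * (1 + s * Im \<omega>) + Re z * Im \<omega>"
      unfolding H_def V_def by (simp add: algebra_simps)
    then show "Im (\<omega> * z) = Im (H (V (H z)))" unfolding a by (simp add: mult.commute)
  qed
  have "emeasure (distr lborel borel ((*) \<omega>)) A = (\<integral>\<^sup>+ z. f (\<omega> * z) \<partial>lborel)"
    by (subst nn_integral_indicator[symmetric], simp, subst nn_integral_distr) (auto simp: f_def)
  also have "\<dots> = (\<integral>\<^sup>+ z. f (H (V (H z))) \<partial>lborel)" by (simp add: eq)
  also have "\<dots> = (\<integral>\<^sup>+ z. f (H (V z)) \<partial>lborel)"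
    using nn_integral_shear(1)[of "\<lambda>z. f (H (V z))" s] by (simp add: H_def)
  also have "\<dots> = (\<integral>\<^sup>+ z. f (H z) \<partial>lborel)"
    using nn_integral_shear(2)[of "\<lambda>z. f (H z)" "Im \<omega>"] by (simp add: V_def)
  also have "\<dots> = (\<integral>\<^sup>+ z. f z \<partial>lborel)"
    using nn_integral_shear(1)[of f s] by (simp add: H_def)
  finally show "emeasure (distr lborel borel ((*) \<omega>)) A = emeasure lborel A"
    by (simp add: f_def)
qed simp

lemma lborel_cnj: "distr lborel borel cnj = lborel"
proof -
  have "(\<lambda>x. 0 + (\<Sum>j\<in>Basis. ((if j = 1 then 1 else -1) * (x \<bullet> j)) *\<^sub>R j)) = cnj"
    by (auto simp: Basis_complex_def fun_eq_iff complex_eq_iff)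
  then show ?thesis
    using lborel_affine_euclidean[where c = "\<lambda>j::complex. if j = 1 then 1 else -1" and t = 0]
    by (simp add: Basis_complex_def density_1)
qed

section \<open>The Bergman measure\<close>

lemma space_bergman_measure [simp]: "space (bergman_measure \<alpha>) = UNIV"
  and sets_bergman_measure [simp, measurable_cong]: "sets (bergman_measure \<alpha>) = sets borel"
  by (simp_all add: bergman_measure_def)

lemma measurable_bergman_weight [measurable]:
  "(\<lambda>z. indicator unit_disk z * ennreal ((\<alpha> + 1) * (1 - (cmod z)\<^sup>2) powr \<alpha> / pi)) \<in> borel_measurable borel"
proof -
  have [measurable]: "unit_disk \<in> sets borel" by simp
  have [measurable]: "(\<lambda>z::complex. (1 - (cmod z)\<^sup>2) powr \<alpha>) \<in> borel_measurable borel"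
    by (intro powr_real_measurable) simp_all
  show ?thesis by measurable
qed

lemma distr_bergman_measure:
  assumes [measurable]: "T \<in> borel_measurable borel"
    and T: "\<And>z. cmod (T z) = cmod z" "distr lborel borel T = lborel"
  shows "distr (bergman_measure \<alpha>) borel T = bergman_measure \<alpha>"
proof (rule measure_eqI)
  fix A assume "A \<in> sets (distr (bergman_measure \<alpha>) borel T)"
  then have [measurable]: "A \<in> sets borel" by simp
  define w where "w = (\<lambda>z. indicator unit_disk z * ennreal ((\<alpha> + 1) * (1 - (cmod z)\<^sup>2) powr \<alpha> / pi))"
  have [measurable]: "w \<in> borel_measurable borel" unfolding w_def by measurable
  have TA [measurable]: "T -` A \<in> sets borel" using measurable_sets[of T borel borel A] by simp
  have w: "w (T z) = w z" for z by (simp add: w_def T(1) indicator_def)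
  have "emeasure (distr (bergman_measure \<alpha>) borel T) A = emeasure (density lborel w) (T -` A)"
    by (simp add: emeasure_distr bergman_measure_def w_def)
  also have "\<dots> = (\<integral>\<^sup>+ z. w (T z) * indicator A (T z) \<partial>lborel)"
    by (subst emeasure_density) (auto simp: w indicator_def intro!: nn_integral_cong)
  also have "\<dots> = (\<integral>\<^sup>+ z. w z * indicator A z \<partial>distr lborel borel T)"
    by (subst nn_integral_distr) auto
  also have "\<dots> = emeasure (bergman_measure \<alpha>) A"
    unfolding T(2) by (simp add: emeasure_density bergman_measure_def w_def)
  finally show "emeasure (distr (bergman_measure \<alpha>) borel T) A = emeasure (bergman_measure \<alpha>) A" .
qed simp

text \<open>For negative \<open>\<alpha>\<close> the density is unbounded near the unit circle. The ring \<open>1 - |z|\<^sup>2 \<le> 2\<^sup>-\<^sup>m\<close>, called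
  \<open>A m\<close> below, has area \<open>\<pi> 2\<^sup>-\<^sup>m\<close>, and where \<open>1 - |z|\<^sup>2\<close> is comparable to \<open>2\<^sup>-\<^sup>m\<close> the density is at most
  a constant times \<open>2\<close> to the power \<open>-\<alpha> m\<close>. So the total mass is dominated by a geometric
  series with ratio \<open>q = 2 powr (- (\<alpha> + 1))\<close>, which is less than 1 exactly when \<open>\<alpha> > -1\<close>.\<close>

lemma finite_measure_bergman:
  assumes "\<alpha> > -1"
  shows "finite_measure (bergman_measure \<alpha>)"
proof (rule finite_measureI)
  define q where "q = (2::real) powr (- (\<alpha> + 1))"
  have q: "0 < q" "q < 1" using assms by (auto simp: q_def intro: powr_less_one)
  define c where "c = (\<alpha> + 1) * (1 + 2 powr (-\<alpha>)) / pi"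
  have c: "c \<ge> 0" using assms by (simp add: c_def)
  define A where "A m = ball (0::complex) 1 - ball 0 (sqrt (1 - 2 powr (- real m)))" for m
  have [measurable]: "A m \<in> sets borel" for m by (simp add: A_def)
  have r: "0 \<le> 1 - (2::real) powr (- real m)" "1 - (2::real) powr (- real m) \<le> 1" for m
    by (auto simp: powr_le_one_le powr_minus powr_realpow field_simps)
  have area: "emeasure lborel (A m) = ennreal (pi * 2 powr (- real m))" for m
  proof -
    have "sqrt (1 - 2 powr (- real m)) \<le> 1" using r[of m] by (intro real_le_lsqrt) auto
    then have "ball (0::complex) (sqrt (1 - 2 powr (- real m))) \<subseteq> ball 0 1"
      by (rule subset_ball)
    then have "emeasure lborel (A m) = emeasure lborel (ball (0::complex) 1) - 
        emeasure lborel (ball (0::complex) (sqrt (1 - 2 powr (- real m))))"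
      unfolding A_def by (subst emeasure_Diff) (use r[of m] in \<open>auto simp: emeasure_ball\<close>)
    also have "\<dots> = ennreal (pi - pi * (1 - 2 powr (- real m)))"
      using r[of m] by (simp add: emeasure_ball unit_ball_vol_2 ennreal_minus)
    finally show ?thesis by (simp add: algebra_simps)
  qed
  have pw: "indicator unit_disk z * ennreal ((\<alpha> + 1) * (1 - (cmod z)\<^sup>2) powr \<alpha> / pi)
      \<le> (\<Sum>m. ennreal (c * 2 powr (- \<alpha> * m)) * indicator (A m) z)" for z
  proof (cases "z \<in> unit_disk")
    case True
    define u where "u = 1 - (cmod z)\<^sup>2"
    have u: "0 < u" "u \<le> 1" using True by (auto simp: u_def abs_square_less_1)
    \<comment> \<open>The dyadic scale of \<open>z\<close>: the \<open>m\<close> with \<open>2 powr (-m-1) \<le> u \<le> 2 powr (-m)\<close>.\<close>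
    define m where "m = nat \<lfloor>- log 2 u\<rfloor>"
    have l: "- log 2 u \<ge> 0" using u by (simp add: log_le_zero_cancel_iff)
    have m1: "real m \<le> - log 2 u" "- log 2 u \<le> m + 1" unfolding m_def using l by linarith+
    have u1: "u \<le> 2 powr (- real m)" using m1 u by (subst log_le_iff[symmetric]) auto
    have u2: "2 powr (- real m - 1) \<le> u" using m1 u by (subst le_log_iff[symmetric]) auto
    have zA: "z \<in> A m"
    proof -
      have "1 - 2 powr (- real m) \<le> (cmod z)\<^sup>2" using u1 by (simp add: u_def)
      then have "sqrt (1 - 2 powr (- real m)) \<le> cmod z" by (simp add: real_le_lsqrt)
      then show ?thesis using True by (simp add: A_def)
    qed
    \<comment> \<open>The upper bound on \<open>u\<close> serves for \<open>\<alpha> \<ge> 0\<close>, the lower one for \<open>\<alpha> < 0\<close>, where the power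
        decreases; the factor \<open>1 + 2 powr (-\<alpha>)\<close> covers both.\<close>
    have "u powr \<alpha> \<le> (1 + 2 powr (-\<alpha>)) * 2 powr (- \<alpha> * m)"
    proof (cases "\<alpha> \<ge> 0")
      case True
      have "u powr \<alpha> \<le> (2 powr (- real m)) powr \<alpha>" using u u1 True by (intro powr_mono2) auto
      also have "\<dots> = 2 powr (- \<alpha> * m)" by (simp add: powr_powr mult.commute)
      also have "\<dots> \<le> (1 + 2 powr (-\<alpha>)) * 2 powr (- \<alpha> * m)" by (simp add: algebra_simps)
      finally show ?thesis .
    next
      case False
      have "u powr \<alpha> \<le> (2 powr (- real m - 1)) powr \<alpha>" using u u2 False by (intro powr_mono2') auto
      also have "\<dots> = 2 powr (-\<alpha>) * 2 powr (- \<alpha> * m)" 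
      proof -
        have e: "(- real m - 1) * \<alpha> = - \<alpha> + - \<alpha> * m" by (simp add: algebra_simps)
        show ?thesis unfolding powr_powr e powr_add ..
      qed
      also have "\<dots> \<le> (1 + 2 powr (-\<alpha>)) * 2 powr (- \<alpha> * m)" by (simp add: algebra_simps)
      finally show ?thesis .
    qed
    then have "((\<alpha> + 1) / pi) * u powr \<alpha> \<le> ((\<alpha> + 1) / pi) * ((1 + 2 powr (-\<alpha>)) * 2 powr (- \<alpha> * m))"
      using assms by (intro mult_left_mono) auto
    then have "(\<alpha> + 1) * u powr \<alpha> / pi \<le> c * 2 powr (- \<alpha> * m)"
      by (simp add: c_def)
    then have "indicator unit_disk z * ennreal ((\<alpha> + 1) * (1 - (cmod z)\<^sup>2) powr \<alpha> / pi) 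
      \<le> ennreal (c * 2 powr (- \<alpha> * m)) * indicator (A m) z"
      using True zA by (simp add: u_def ennreal_leI)
    also have "\<dots> \<le> (\<Sum>m. ennreal (c * 2 powr (- \<alpha> * m)) * indicator (A m) z)"
    proof -
      define F where "F = (\<lambda>m. ennreal (c * 2 powr (- \<alpha> * real m)) * indicator (A m) z)"
      have "sum F {m} \<le> suminf F" by (rule sum_le_suminf) auto
      then have "F m \<le> suminf F" by simp
      then show ?thesis unfolding F_def .
    qed
    finally show ?thesis .
  qed simp
  have "emeasure (bergman_measure \<alpha>) (space (bergman_measure \<alpha>)) 
    = (\<integral>\<^sup>+ z. indicator unit_disk z * ennreal ((\<alpha> + 1) * (1 - (cmod z)\<^sup>2) powr \<alpha> / pi) \<partial>lborel)"
    by (simp add: bergman_measure_def emeasure_density)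
  also have "\<dots> \<le> (\<integral>\<^sup>+ z. (\<Sum>m. ennreal (c * 2 powr (- \<alpha> * m)) * indicator (A m) z) \<partial>lborel)"
    by (intro nn_integral_mono pw)
  also have "\<dots> = (\<Sum>m. \<integral>\<^sup>+ z. ennreal (c * 2 powr (- \<alpha> * m)) * indicator (A m) z \<partial>lborel)"
    by (rule nn_integral_suminf) simp
  also have "\<dots> = (\<Sum>m. ennreal (c * pi * q ^ m))"
  proof (rule suminf_cong)
    fix m
    have "(\<integral>\<^sup>+ z. ennreal (c * 2 powr (- \<alpha> * m)) * indicator (A m) z \<partial>lborel)
       = ennreal (c * 2 powr (- \<alpha> * m)) * ennreal (pi * 2 powr (- real m))"
      by (simp add: nn_integral_cmult area)
    also have "\<dots> = ennreal (c * pi * (2 powr (- \<alpha> * m) * 2 powr (- real m)))"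
      using c by (simp add: ennreal_mult[symmetric] mult_ac)
    also have "2 powr (- \<alpha> * m) * 2 powr (- real m) = q ^ m"
      by (simp add: q_def powr_realpow[symmetric] powr_powr powr_add[symmetric] algebra_simps)
    finally show "(\<integral>\<^sup>+ z. ennreal (c * 2 powr (- \<alpha> * m)) * indicator (A m) z \<partial>lborel) = ennreal (c * pi * q ^ m)" .
  qed
  also have "\<dots> = ennreal (\<Sum>m. c * pi * q ^ m)"
    by (rule suminf_ennreal2) (use q c in \<open>auto intro!: summable_mult summable_geometric\<close>)
  also have "\<dots> < \<infinity>" by simp
  finally show "emeasure (bergman_measure \<alpha>) (space (bergman_measure \<alpha>)) \<noteq> \<infinity>" by simp
qed

section \<open>Functions of the Bergman space and their Taylor coefficients\<close>

abbreviation taylor_coeff :: "(complex \<Rightarrow> complex) \<Rightarrow> nat \<Rightarrow> complex" where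
  "taylor_coeff f \<equiv> fps_nth (fps_expansion f 0)"

definition disk_poly :: "complex poly \<Rightarrow> complex \<Rightarrow> complex" where
  "disk_poly p z = (if z \<in> unit_disk then poly p z else 0)"

abbreviation disk_power :: "nat \<Rightarrow> complex \<Rightarrow> complex" where
  "disk_power k \<equiv> disk_poly (monom 1 k)"

lemma disk_power_apply: "disk_power k z = (if z \<in> unit_disk then z ^ k else 0)"
  by (simp add: disk_poly_def poly_monom)

lemma fps_expansion_eqI_on_disk:
  assumes "F has_fps_expansion G" "\<And>z. z \<in> unit_disk \<Longrightarrow> f z = F z"
  shows "fps_expansion f 0 = G"
proof (rule fps_expansion_eqI)
  have "eventually (\<lambda>z. z \<in> unit_disk) (nhds (0::complex))"
    by (intro eventually_nhds_in_open) auto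
  then have "eventually (\<lambda>z. f z = F z) (nhds 0)"
    by eventually_elim (rule assms(2))
  then show "f has_fps_expansion G"
    using assms(1) has_fps_expansion_cong by blast
qed

lemma taylor_sums:
  assumes "f holomorphic_on unit_disk" "z \<in> unit_disk"
  shows "(\<lambda>k. taylor_coeff f k * z ^ k) sums f z"
  using holomorphic_power_series[OF assms] by (simp add: fps_expansion_def)

lemma bergman_space_eqI:
  assumes "f \<in> bergman_space \<alpha>" "g \<in> bergman_space \<alpha>"
    and "\<And>k. taylor_coeff f k = taylor_coeff g k"
  shows "f = g"
proof
  fix z show "f z = g z"
  proof (cases "z \<in> unit_disk")
    case True
    then have "(\<lambda>k. taylor_coeff f k * z ^ k) sums f z" "(\<lambda>k. taylor_coeff f k * z ^ k) sums g z"
      using taylor_sums[of f z] taylor_sums[of g z] assms by (auto simp: bergman_space_def)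
    then show ?thesis by (rule sums_unique2)
  qed (use assms in \<open>auto simp: bergman_space_def\<close>)
qed

lemma borel_measurable_bergman:
  assumes "f \<in> bergman_space \<alpha>"
  shows "f \<in> borel_measurable borel"
proof -
  have "(\<lambda>z. indicator unit_disk z *\<^sub>R f z) \<in> borel_measurable borel"
    using assms by (intro borel_measurable_continuous_on_indicator)
      (auto simp: bergman_space_def holomorphic_on_imp_continuous_on)
  moreover have "(\<lambda>z. indicator unit_disk z *\<^sub>R f z) = f"
    using assms by (auto simp: bergman_space_def fun_eq_iff indicator_def)
  ultimately show ?thesis by simp
qed

lemma bergman_space_integrable_mult:
  assumes f: "f \<in> bergman_space \<alpha>" and g: "g \<in> bergman_space \<alpha>"
  shows "integrable (bergman_measure \<alpha>) (\<lambda>z. f z * cnj (g z))"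
proof (rule Bochner_Integration.integrable_bound)
  show "integrable (bergman_measure \<alpha>) (\<lambda>z. (cmod (f z))\<^sup>2 + (cmod (g z))\<^sup>2)"
    using f g by (auto simp: bergman_space_def)
  have m: "f \<in> borel_measurable borel" "g \<in> borel_measurable borel"
    using f g by (auto intro: borel_measurable_bergman)
  have "(\<lambda>z. f z * cnj (g z)) \<in> borel_measurable borel"
    by (intro borel_measurable_times m borel_measurable_continuous_on[OF _ m(2), of cnj] continuous_intros)
  then show "(\<lambda>z. f z * cnj (g z)) \<in> borel_measurable (bergman_measure \<alpha>)" by simp
  have "a * b \<le> a\<^sup>2 + b\<^sup>2" if "a \<ge> 0" "b \<ge> 0" for a b :: real
    using sum_squares_bound[of a b] that mult_nonneg_nonneg[OF that] by linarith
  then show "AE z in bergman_measure \<alpha>. cmod (f z * cnj (g z)) \<le> norm ((cmod (f z))\<^sup>2 + (cmod (g z))\<^sup>2)"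
    by (simp add: norm_mult)
qed

lemma disk_poly_in_bergman_space:
  assumes "\<alpha> > -1"
  shows "disk_poly p \<in> bergman_space \<alpha>"
proof -
  interpret finite_measure "bergman_measure \<alpha>" by (rule finite_measure_bergman[OF assms])
  have h: "disk_poly p holomorphic_on unit_disk"
    by (rule holomorphic_transform[of "poly p"]) (auto simp: disk_poly_def intro!: poly_holomorphic_on[OF holomorphic_on_id[unfolded id_def]])
  have "compact (poly p ` cball 0 1)"
    by (intro compact_continuous_image continuous_intros) auto
  then obtain C where C: "\<And>z. cmod z \<le> 1 \<Longrightarrow> cmod (poly p z) \<le> C"
    by (metis bounded_iff compact_imp_bounded image_eqI mem_cball_0)
  have C0: "C \<ge> 0" using C[of 0] order_trans[OF norm_ge_zero] by simp
  have bound: "cmod (disk_poly p z) \<le> C" for z using C[of z] C0 by (auto simp: disk_poly_def)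
  have "(\<lambda>z. indicator unit_disk z *\<^sub>R poly p z) \<in> borel_measurable borel"
    by (intro borel_measurable_continuous_on_indicator continuous_intros) auto
  also have "(\<lambda>z. indicator unit_disk z *\<^sub>R poly p z) = disk_poly p"
    by (auto simp: disk_poly_def fun_eq_iff indicator_def)
  finally have "(\<lambda>z. (cmod (disk_poly p z))\<^sup>2) \<in> borel_measurable borel" by simp
  then have "integrable (bergman_measure \<alpha>) (\<lambda>z. (cmod (disk_poly p z))\<^sup>2)"
    using bound by (intro integrable_const_bound[where B = "C\<^sup>2"]) (auto intro!: power_mono)
  with h show ?thesis by (auto simp: bergman_space_def disk_poly_def)
qed

lemma taylor_coeff_disk_poly [simp]: "taylor_coeff (disk_poly p) k = coeff p k"
proof -
  have "fps_expansion (disk_poly p) 0 = fps_of_poly p"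
    by (rule fps_expansion_eqI_on_disk[where F = "poly p"]) (auto simp: disk_poly_def has_fps_expansion_def)
  then show ?thesis by simp
qed

section \<open>Inner products through Taylor coefficients\<close>

text \<open>The inner product with the integral restricted to a smaller disk. For \<open>r < 1\<close> power series
  may be integrated term by term over that disk, because they converge there boundedly; the
  inner product of the space is recovered as \<open>r\<close> tends to 1.\<close>

definition truncated_inner :: "real \<Rightarrow> real \<Rightarrow> (complex \<Rightarrow> complex) \<Rightarrow> (complex \<Rightarrow> complex) \<Rightarrow> complex" where
  "truncated_inner \<alpha> r f g = (LINT z|bergman_measure \<alpha>. indicator (ball 0 r) z *\<^sub>R (f z * cnj (g z)))"

lemma truncated_inner_cnj: "cnj (truncated_inner \<alpha> r f g) = truncated_inner \<alpha> r g f"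
  unfolding truncated_inner_def
  by (subst Bochner_Integration.integral_cnj[symmetric]) (auto intro!: Bochner_Integration.integral_cong simp: mult.commute)

lemma measurable_truncated:
  assumes f: "f \<in> bergman_space \<alpha>" and g: "g \<in> bergman_space \<alpha>"
  shows "(\<lambda>z. indicator (ball 0 r) z *\<^sub>R (f z * cnj (g z))) \<in> borel_measurable borel"
proof -
  have 1: "(\<lambda>z. f z * cnj (g z)) \<in> borel_measurable borel"
    using borel_measurable_integrable[OF bergman_space_integrable_mult[OF f g]] by simp
  show ?thesis
    by (intro borel_measurable_scaleR borel_measurable_indicator 1) simp
qed

text \<open>Rotating by \<open>\<omega>\<close> leaves the measure and the disk alone but multiplies the integrand by
  \<open>\<omega>\<close> to the power \<open>j - k\<close>, so the integral vanishes as soon as this factor is not 1.\<close>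

lemma truncated_inner_disk_power_orthogonal:
  assumes \<alpha>: "\<alpha> > -1" and jk: "j \<noteq> k"
  shows "truncated_inner \<alpha> r (disk_power j) (disk_power k) = 0"
proof -
  define d where "d = \<bar>real j - real k\<bar>"
  have d: "d \<ge> 1" using jk by (auto simp: d_def)
  \<comment> \<open>With this angle the factor is \<open>\<i>\<close> or \<open>-\<i>\<close>, and \<open>\<omega>\<close> is never real.\<close>
  define \<omega> where "\<omega> = cis (pi / (2 * d))"
  have "0 < pi / (2 * d)" "pi / (2 * d) < pi" using d by (auto simp: field_simps)
  then have "sin (pi / (2 * d)) > 0" by (rule sin_gt_zero)
  then have \<omega>: "cmod \<omega> = 1" "Im \<omega> \<noteq> 0" by (auto simp: \<omega>_def)
  define G where "G = (\<lambda>z. indicator (ball 0 r) z *\<^sub>R (disk_power j z * cnj (disk_power k z)))"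
  have G [measurable]: "G \<in> borel_measurable borel"
    unfolding G_def by (intro measurable_truncated[of _ \<alpha>] disk_poly_in_bergman_space \<alpha>)
  have *: "G (\<omega> * z) = \<omega> ^ j * cnj \<omega> ^ k * G z" for z
    using \<omega>(1) by (auto simp: G_def disk_power_apply norm_mult indicator_def power_mult_distrib)
  have "\<omega> ^ j * cnj \<omega> ^ k = cis ((real j - real k) * pi / (2 * d))"
    unfolding \<omega>_def cis_cnj Complex.DeMoivre cis_mult
    by (simp add: diff_divide_distrib left_diff_distrib)
  moreover have "(real j - real k) * pi / (2 * d) \<in> {pi / 2, - (pi / 2)}"
    using jk by (auto simp: d_def abs_if field_simps)
  moreover have "sin x \<noteq> 0" if "x \<in> {pi / 2, - (pi / 2)}" for x :: real
    using that by (elim insertE emptyE; hypsubst) simp_all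
  ultimately have "Im (\<omega> ^ j * cnj \<omega> ^ k) \<noteq> 0" by simp
  then have ne: "\<omega> ^ j * cnj \<omega> ^ k \<noteq> 1" by (metis one_complex.sel(2))
  have "integral\<^sup>L (bergman_measure \<alpha>) G = integral\<^sup>L (distr (bergman_measure \<alpha>) borel ((*) \<omega>)) G"
    using \<omega> by (subst distr_bergman_measure) (auto simp: norm_mult lborel_rotation)
  also have "\<dots> = (LINT z|bergman_measure \<alpha>. G (\<omega> * z))"
    by (rule integral_distr) auto
  also have "\<dots> = \<omega> ^ j * cnj \<omega> ^ k * integral\<^sup>L (bergman_measure \<alpha>) G"
    unfolding * by simp
  finally have "(1 - \<omega> ^ j * cnj \<omega> ^ k) * integral\<^sup>L (bergman_measure \<alpha>) G = 0"
    by (simp add: left_diff_distrib)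
  then have "integral\<^sup>L (bergman_measure \<alpha>) G = 0" using ne by auto
  then show ?thesis by (simp only: truncated_inner_def G_def)
qed

lemma bergman_bounded_on_smaller_disk:
  assumes "f \<in> bergman_space \<alpha>" "r < 1"
  obtains C where "C \<ge> 0" "\<And>z. z \<in> ball 0 r \<Longrightarrow> cmod (f z) \<le> C"
proof -
  have "continuous_on (cball 0 r) f"
    using assms by (intro holomorphic_on_imp_continuous_on[THEN continuous_on_subset, of f unit_disk])
      (auto simp: bergman_space_def)
  then have "compact (f ` cball 0 r)" by (intro compact_continuous_image) auto
  then have "bounded (f ` cball 0 r)" by (rule compact_imp_bounded)
  then obtain C where C: "C > 0" "\<forall>w\<in>f ` cball 0 r. cmod w \<le> C"
    unfolding bounded_pos by blast
  show thesis
  proof (rule that)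
    show "C \<ge> 0" using C(1) by simp
    show "cmod (f z) \<le> C" if "z \<in> ball 0 r" for z using C(2) that by auto
  qed
qed

text \<open>Dominated convergence: on the disk of radius \<open>r\<close> all partial sums of \<open>f\<close> are bounded by
  \<open>\<Sum>k. |a\<^sub>k| r\<^sup>k\<close>, and \<open>g\<close> is bounded as well.\<close>

lemma truncated_inner_sums:
  assumes \<alpha>: "\<alpha> > -1" and f: "f \<in> bergman_space \<alpha>" and g: "g \<in> bergman_space \<alpha>" and r: "0 < r" "r < 1"
  shows "(\<lambda>k. taylor_coeff f k * truncated_inner \<alpha> r (disk_power k) g) sums truncated_inner \<alpha> r f g"
proof -
  interpret finite_measure "bergman_measure \<alpha>" by (rule finite_measure_bergman[OF \<alpha>])
  obtain C where C: "C \<ge> 0" "\<And>z. z \<in> ball 0 r \<Longrightarrow> cmod (g z) \<le> C"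
    using bergman_bounded_on_smaller_disk[OF g r(2)] by metis
  have hf: "f holomorphic_on unit_disk" using f by (simp add: bergman_space_def)
  obtain \<rho> where \<rho>: "r < \<rho>" "\<rho> < 1" using dense r(2) by blast
  have "summable (\<lambda>k. taylor_coeff f k * of_real \<rho> ^ k)"
    using taylor_sums[OF hf, of "of_real \<rho>"] \<rho> r by (auto simp: sums_iff)
  from powser_insidea[OF this, of "of_real r"] have 
    S: "summable (\<lambda>k. cmod (taylor_coeff f k) * r ^ k)"
    using \<rho> r by (simp add: norm_mult norm_power)
  define P where "P N = (\<lambda>z. \<Sum>k<N. taylor_coeff f k * disk_power k z)" for N
  define h where "h N = (\<lambda>z. indicator (ball 0 r) z *\<^sub>R (P N z * cnj (g z)))" for N
  have i1: "integrable (bergman_measure \<alpha>) (\<lambda>z. indicator (ball 0 r) z *\<^sub>R (disk_power k z * cnj (g z)))" for k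
    using bergman_space_integrable_mult[OF disk_poly_in_bergman_space[OF \<alpha>] g, of "monom 1 k"]
    by (intro integrable_mult_indicator) auto
  have h: "h N = (\<lambda>z. \<Sum>k<N. taylor_coeff f k * (indicator (ball 0 r) z *\<^sub>R (disk_power k z * cnj (g z))))" for N
    unfolding h_def P_def sum_distrib_right scaleR_sum_right by (simp add: mult.assoc)
  have lim: "(\<lambda>N. integral\<^sup>L (bergman_measure \<alpha>) (h N)) \<longlonglongrightarrow> truncated_inner \<alpha> r f g"
    unfolding truncated_inner_def
  proof (rule integral_dominated_convergence[where w = "\<lambda>_. (\<Sum>k. cmod (taylor_coeff f k) * r ^ k) * C"])
    show "(\<lambda>z. indicator (ball 0 r) z *\<^sub>R (f z * cnj (g z))) \<in> borel_measurable (bergman_measure \<alpha>)"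
      using measurable_truncated[OF f g] by simp
    show "h N \<in> borel_measurable (bergman_measure \<alpha>)" for N
      unfolding h using borel_measurable_integrable[OF i1] by (intro borel_measurable_sum borel_measurable_times) auto
    show "AE z in bergman_measure \<alpha>. (\<lambda>N. h N z) \<longlonglongrightarrow> indicator (ball 0 r) z *\<^sub>R (f z * cnj (g z))"
    proof (intro AE_I2)
      fix z :: complex
      show "(\<lambda>N. h N z) \<longlonglongrightarrow> indicator (ball 0 r) z *\<^sub>R (f z * cnj (g z))"
      proof (cases "z \<in> ball 0 r")
        case True
        then have z: "z \<in> unit_disk" using r by auto
        have "(\<lambda>N. P N z) \<longlonglongrightarrow> f z"
          using taylor_sums[OF hf z] z by (simp add: P_def disk_power_apply sums_def)
        then show ?thesis unfolding h_def by (intro tendsto_intros)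
      qed (simp add: h_def)
    qed
    show "AE z in bergman_measure \<alpha>. norm (h N z) \<le> (\<Sum>k. cmod (taylor_coeff f k) * r ^ k) * C" for N
    proof (intro AE_I2)
      fix z :: complex
      have nn: "(\<Sum>k. cmod (taylor_coeff f k) * r ^ k) \<ge> 0"
        using r by (intro suminf_nonneg S) auto
      show "norm (h N z) \<le> (\<Sum>k. cmod (taylor_coeff f k) * r ^ k) * C"
      proof (cases "z \<in> ball 0 r")
        case True
        then have z: "z \<in> unit_disk" "cmod z \<le> r" using r by auto
        have "cmod (P N z) \<le> (\<Sum>k<N. cmod (taylor_coeff f k * disk_power k z))"
          unfolding P_def by (rule norm_sum)
        also have "\<dots> \<le> (\<Sum>k<N. cmod (taylor_coeff f k) * r ^ k)"
          using z by (intro sum_mono) (auto simp: disk_power_apply norm_mult norm_power intro!: mult_left_mono power_mono)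
        also have "\<dots> \<le> (\<Sum>k. cmod (taylor_coeff f k) * r ^ k)"
          using S r by (intro sum_le_suminf) auto
        finally have "cmod (P N z) * cmod (g z) \<le> (\<Sum>k. cmod (taylor_coeff f k) * r ^ k) * C"
          using C(2)[OF True] nn by (intro mult_mono) auto
        then show ?thesis using True by (simp add: h_def norm_mult)
      qed (use C nn in \<open>simp add: h_def\<close>)
    qed
  qed simp
  have "integral\<^sup>L (bergman_measure \<alpha>) (h N) = (\<Sum>k<N. taylor_coeff f k * truncated_inner \<alpha> r (disk_power k) g)" for N
    unfolding h truncated_inner_def
    by (subst Bochner_Integration.integral_sum)
      (rule integrable_mult_right[OF i1], simp del: mult_scaleR_right)
  with lim show ?thesis by (simp add: sums_def)
qed

text \<open>Expand first \<open>f\<close> and then \<open>g\<close>; orthogonality leaves one term of the second expansion.\<close>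

lemma truncated_parseval:
  assumes \<alpha>: "\<alpha> > -1" and f: "f \<in> bergman_space \<alpha>" and g: "g \<in> bergman_space \<alpha>" and r: "0 < r" "r < 1"
  shows "(\<lambda>k. taylor_coeff f k * cnj (taylor_coeff g k) * truncated_inner \<alpha> r (disk_power k) (disk_power k))
    sums truncated_inner \<alpha> r f g"
proof -
  have "truncated_inner \<alpha> r g (disk_power k) = taylor_coeff g k * truncated_inner \<alpha> r (disk_power k) (disk_power k)" for k
  proof -
    have "(\<lambda>j. taylor_coeff g j * truncated_inner \<alpha> r (disk_power j) (disk_power k)) sums
        truncated_inner \<alpha> r g (disk_power k)"
      by (intro truncated_inner_sums disk_poly_in_bergman_space \<alpha> g r)
    moreover have "(\<lambda>j. taylor_coeff g j * truncated_inner \<alpha> r (disk_power j) (disk_power k)) sums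
        (\<Sum>j\<in>{k}. taylor_coeff g j * truncated_inner \<alpha> r (disk_power j) (disk_power k))"
      by (rule sums_finite) (auto simp: truncated_inner_disk_power_orthogonal[OF \<alpha>])
    ultimately show ?thesis using sums_unique2 by fastforce
  qed
  then have "truncated_inner \<alpha> r (disk_power k) g
      = cnj (taylor_coeff g k) * truncated_inner \<alpha> r (disk_power k) (disk_power k)" for k
    by (metis complex_cnj_mult truncated_inner_cnj)
  with truncated_inner_sums[OF \<alpha> f g r] show ?thesis by (simp add: mult.assoc)
qed

lemma truncated_inner_tendsto:
  assumes f: "f \<in> bergman_space \<alpha>" and g: "g \<in> bergman_space \<alpha>"
  shows "(\<lambda>m. truncated_inner \<alpha> (1 - 1 / (real m + 2)) f g) \<longlonglongrightarrow> bergman_inner \<alpha> f g"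
  unfolding truncated_inner_def bergman_inner_def
proof (rule integral_dominated_convergence[where w = "\<lambda>z. cmod (f z * cnj (g z))"])
  have r: "(\<lambda>m. 1 - 1 / (real m + 2)) \<longlonglongrightarrow> 1" by real_asymp
  show "AE z in bergman_measure \<alpha>.
    (\<lambda>m. indicator (ball 0 (1 - 1 / (real m + 2))) z *\<^sub>R (f z * cnj (g z))) \<longlonglongrightarrow> f z * cnj (g z)"
  proof (intro AE_I2)
    fix z :: complex
    show "(\<lambda>m. indicator (ball 0 (1 - 1 / (real m + 2))) z *\<^sub>R (f z * cnj (g z))) \<longlonglongrightarrow> f z * cnj (g z)"
    proof (cases "z \<in> unit_disk")
      case True
      then have "eventually (\<lambda>m. cmod z < 1 - 1 / (real m + 2)) sequentially"
        using order_tendstoD(1)[OF r, of "cmod z"] by simp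
      then show ?thesis
        by (intro tendsto_eventually) (auto elim!: eventually_mono)
    qed (use f in \<open>simp add: bergman_space_def\<close>)
  qed
  show "AE z in bergman_measure \<alpha>.
      norm (indicator (ball 0 (1 - 1 / (real m + 2))) z *\<^sub>R (f z * cnj (g z))) \<le> cmod (f z * cnj (g z))" for m
    by (intro AE_I2) (auto simp: indicator_def)
qed (use measurable_truncated[OF f g] bergman_space_integrable_mult[OF f g] in auto)

lemma truncation_radius: "0 < 1 - 1 / (real m + 2)" "1 - 1 / (real m + 2) < 1"
  by (auto simp: field_simps)

text \<open>The next two lemmas are the forms of Parseval's identity that survive the limit \<open>r \<rightarrow> 1\<close> without
  exchanging it with an infinite sum: in the first the truncated inner products already agree
  for every \<open>r\<close>, in the second the sum is finite.\<close>

lemma bergman_inner_eqI: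
  assumes \<alpha>: "\<alpha> > -1" and "f \<in> bergman_space \<alpha>" "g \<in> bergman_space \<alpha>" "f' \<in> bergman_space \<alpha>" "g' \<in> bergman_space \<alpha>"
    and "\<And>k. taylor_coeff f k * cnj (taylor_coeff g k) = taylor_coeff f' k * cnj (taylor_coeff g' k)"
  shows "bergman_inner \<alpha> f g = bergman_inner \<alpha> f' g'"
proof -
  have "truncated_inner \<alpha> (1 - 1 / (real m + 2)) f g = truncated_inner \<alpha> (1 - 1 / (real m + 2)) f' g'" for m
    using truncated_parseval[OF \<alpha> assms(2,3) truncation_radius]
      truncated_parseval[OF \<alpha> assms(4,5) truncation_radius] 
    unfolding assms(6) by (rule sums_unique2)
  then show ?thesis
    using truncated_inner_tendsto[OF assms(2,3)] truncated_inner_tendsto[OF assms(4,5)]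
    by (simp add: LIMSEQ_unique)
qed

lemma bergman_inner_finite:
  assumes \<alpha>: "\<alpha> > -1" and f: "f \<in> bergman_space \<alpha>" and g: "g \<in> bergman_space \<alpha>"
    and A: "finite A" "\<And>k. k \<notin> A \<Longrightarrow> taylor_coeff f k * cnj (taylor_coeff g k) = 0"
  shows "bergman_inner \<alpha> f g =
    (\<Sum>k\<in>A. taylor_coeff f k * cnj (taylor_coeff g k) * bergman_inner \<alpha> (disk_power k) (disk_power k))"
proof -
  let ?T = "\<lambda>m. truncated_inner \<alpha> (1 - 1 / (real m + 2))"
  have "(\<lambda>m. ?T m f g) \<longlonglongrightarrow> bergman_inner \<alpha> f g"
    by (rule truncated_inner_tendsto[OF f g])
  moreover have "?T m f g = (\<Sum>k\<in>A. taylor_coeff f k * cnj (taylor_coeff g k) * ?T m (disk_power k) (disk_power k))" for m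
  proof (rule sums_unique2[OF truncated_parseval[OF \<alpha> f g truncation_radius]])
    show "(\<lambda>k. taylor_coeff f k * cnj (taylor_coeff g k) * ?T m (disk_power k) (disk_power k)) sums
      (\<Sum>k\<in>A. taylor_coeff f k * cnj (taylor_coeff g k) * ?T m (disk_power k) (disk_power k))"
      using A by (intro sums_finite) auto
  qed
  moreover have "(\<lambda>m. \<Sum>k\<in>A. taylor_coeff f k * cnj (taylor_coeff g k) * ?T m (disk_power k) (disk_power k)) \<longlonglongrightarrow>
     (\<Sum>k\<in>A. taylor_coeff f k * cnj (taylor_coeff g k) * bergman_inner \<alpha> (disk_power k) (disk_power k))"
    by (intro tendsto_intros truncated_inner_tendsto disk_poly_in_bergman_space \<alpha>)
  ultimately show ?thesis by (simp add: LIMSEQ_unique)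
qed

lemma bergman_inner_disk_power_nonzero:
  assumes \<alpha>: "\<alpha> > -1"
  shows "bergman_inner \<alpha> (disk_power k) (disk_power k) \<noteq> 0"
proof
  define w where "w = (\<lambda>z::complex. indicator unit_disk z * ennreal ((\<alpha> + 1) * (1 - (cmod z)\<^sup>2) powr \<alpha> / pi))"
  have w: "w \<in> borel_measurable lborel" unfolding w_def by measurable
  assume "bergman_inner \<alpha> (disk_power k) (disk_power k) = 0"
  moreover have "bergman_inner \<alpha> (disk_power k) (disk_power k)
      = of_real (LINT z|bergman_measure \<alpha>. (cmod (disk_power k z))\<^sup>2)"
    unfolding bergman_inner_def complex_norm_square[symmetric] integral_complex_of_real ..
  ultimately have z: "(LINT z|bergman_measure \<alpha>. (cmod (disk_power k z))\<^sup>2) = 0" by simp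
  have i: "integrable (bergman_measure \<alpha>) (\<lambda>z. (cmod (disk_power k z))\<^sup>2)"
    using disk_poly_in_bergman_space[OF \<alpha>] by (simp add: bergman_space_def)
  have M: "bergman_measure \<alpha> = density lborel w" by (simp add: bergman_measure_def w_def)
  have "AE z in density lborel w. (cmod (disk_power k z))\<^sup>2 = 0"
    unfolding M[symmetric] by (rule iffD1[OF integral_nonneg_eq_0_iff_AE[OF i] z]) simp
  then have "AE z in lborel. 0 < w z \<longrightarrow> (cmod (disk_power k z))\<^sup>2 = 0"
    by (simp add: AE_density[OF w])
  then have "AE z in lborel. z \<notin> ball (0::complex) 1 - {0}"
  proof eventually_elim
    case (elim z)
    show ?case
    proof
      assume z: "z \<in> ball (0::complex) 1 - {0}"
      then have "(1 - (cmod z)\<^sup>2) > 0" by (simp add: abs_square_less_1)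
      with z \<alpha> have "w z > 0" by (auto simp: w_def)
      with elim z show False by (auto simp: disk_power_apply)
    qed
  qed
  then have "emeasure lborel (ball (0::complex) 1 - {0}) = 0"
    by (rule iffD1[OF AE_iff_measurable, rotated 2]) auto
  moreover have "emeasure lborel (ball (0::complex) 1 - {0}) = emeasure lborel (ball (0::complex) 1)"
    by (subst emeasure_Diff) auto
  ultimately show False by (simp add: emeasure_ball unit_ball_vol_2)
qed

text \<open>Uniqueness in the description of the adjoint: testing against the monomials recovers all
  Taylor coefficients of \<open>h\<close>, since monomials have nonzero norm. So it
  suffices to exhibit one \<open>h\<close> in order to compute the adjoint at \<open>g\<close>.\<close>

lemma hilbert_adjoint_eqI:
  assumes \<alpha>: "\<alpha> > -1" and h: "h \<in> bergman_space \<alpha>"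
    and adj: "\<And>f. f \<in> bergman_space \<alpha> \<Longrightarrow> bergman_inner \<alpha> (T f) g = bergman_inner \<alpha> f h"
  shows "hilbert_adjoint \<alpha> T g = h"
  unfolding hilbert_adjoint_def
proof (rule the_equality)
  fix h' assume h': "h' \<in> bergman_space \<alpha> \<and> (\<forall>f\<in>bergman_space \<alpha>. bergman_inner \<alpha> (T f) g = bergman_inner \<alpha> f h')"
  show "h' = h"
  proof (rule bergman_space_eqI)
    fix k
    have e: "disk_power k \<in> bergman_space \<alpha>" by (rule disk_poly_in_bergman_space[OF \<alpha>])
    have "bergman_inner \<alpha> (disk_power k) u
        = cnj (taylor_coeff u k) * bergman_inner \<alpha> (disk_power k) (disk_power k)"
      if "u \<in> bergman_space \<alpha>" for u
      using bergman_inner_finite[OF \<alpha> e that, of "{k}"] by simp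
    moreover have "bergman_inner \<alpha> (disk_power k) h' = bergman_inner \<alpha> (disk_power k) h"
      using h' adj[OF e] e by simp
    ultimately show "taylor_coeff h' k = taylor_coeff h k"
      using h h' bergman_inner_disk_power_nonzero[OF \<alpha>] by simp
  qed (use h h' in auto)
qed (use assms in auto)

section \<open>The Taylor coefficients of a weighted composition-differentiation\<close>

lemma fps_nth_funpow_deriv:
  "fps_nth ((fps_deriv ^^ n) F) m = fact (m + n) / fact m * fps_nth (F :: complex fps) (m + n)"
proof (induction n arbitrary: m)
  case (Suc n)
  have "fps_nth ((fps_deriv ^^ Suc n) F) m = of_nat (m + 1) * fps_nth ((fps_deriv ^^ n) F) (m + 1)"
    by simp
  also have "\<dots> = of_nat (m + 1) * (fact (m + 1 + n) / fact (m + 1) * fps_nth F (m + 1 + n))"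
    by (simp only: Suc)
  also have "\<dots> = fact (m + Suc n) / fact m * fps_nth F (m + Suc n)"
    by (simp del: of_nat_Suc)
  finally show ?case .
qed simp

lemma fps_nth_mult_power_eq_0:
  fixes \<Psi> \<Phi> :: "complex fps"
  assumes "fps_nth \<Phi> 0 = 0" and "\<And>i. i < n \<Longrightarrow> fps_nth \<Psi> i = 0" and "j < n + m"
  shows "fps_nth (\<Psi> * \<Phi> ^ m) j = 0"
  unfolding fps_mult_nth
proof (intro sum.neutral ballI)
  fix i assume "i \<in> {0..j}"
  then show "fps_nth \<Psi> i * fps_nth (\<Phi> ^ m) (j - i) = 0"
    using assms startsby_zero_power_prefix[of \<Phi> m] by (cases "i < n") auto
qed

text \<open>As \<open>\<Phi>\<close> has no constant term, \<open>\<Phi> ^ m\<close> starts at degree \<open>m\<close>, and so only the coefficients of \<open>G\<close>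
  up to \<open>j\<close> reach degree \<open>j\<close>.\<close>

lemma fps_nth_mult_compose:
  fixes \<Psi> G \<Phi> :: "complex fps"
  assumes "fps_nth \<Phi> 0 = 0"
  shows "fps_nth (\<Psi> * (G oo \<Phi>)) j = (\<Sum>m\<le>j. fps_nth G m * fps_nth (\<Psi> * \<Phi> ^ m) j)"
proof -
  have "fps_nth (G oo \<Phi>) (j - i) = (\<Sum>m\<le>j. fps_nth G m * fps_nth (\<Phi> ^ m) (j - i))" for i
    unfolding fps_compose_nth
    using startsby_zero_power_prefix[OF assms] by (intro sum.mono_neutral_left) auto
  then have "fps_nth (\<Psi> * (G oo \<Phi>)) j
      = (\<Sum>i=0..j. \<Sum>m\<le>j. fps_nth \<Psi> i * (fps_nth G m * fps_nth (\<Phi> ^ m) (j - i)))"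
    by (simp add: fps_mult_nth sum_distrib_left)
  also have "\<dots> = (\<Sum>m\<le>j. \<Sum>i=0..j. fps_nth \<Psi> i * (fps_nth G m * fps_nth (\<Phi> ^ m) (j - i)))"
    by (rule sum.swap)
  also have "\<dots> = (\<Sum>m\<le>j. fps_nth G m * fps_nth (\<Psi> * \<Phi> ^ m) j)"
    by (simp add: fps_mult_nth sum_distrib_left mult_ac)
  finally show ?thesis .
qed

text \<open>By \<open>\<phi> 0 = 0\<close>, each Taylor coefficient of the image depends on finitely many
  Taylor coefficients of \<open>f\<close>, and so the adjoint takes polynomials to polynomials.\<close>

lemma taylor_coeff_weighted_comp_diff:
  assumes f: "f holomorphic_on unit_disk"
    and \<phi>: "\<phi> holomorphic_on unit_disk" "\<phi> 0 = 0" and \<psi>: "\<psi> holomorphic_on unit_disk"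
  shows "taylor_coeff (weighted_comp_diff n \<psi> \<phi> f) j =
    (\<Sum>m\<le>j. fact (m + n) / fact m * taylor_coeff f (m + n)
      * fps_nth (fps_expansion \<psi> 0 * fps_expansion \<phi> 0 ^ m) j)"
proof -
  have ex: "g has_fps_expansion fps_expansion g 0" if "g holomorphic_on unit_disk" for g
    by (rule has_fps_expansion_fps_expansion[OF _ _ that]) auto
  have \<Phi>0: "fps_nth (fps_expansion \<phi> 0) 0 = 0" using \<phi> by (simp add: fps_expansion_def)
  have "(deriv ^^ n) f has_fps_expansion (fps_deriv ^^ n) (fps_expansion f 0)"
    by (induction n) (auto intro: ex f has_fps_expansion_deriv)
  then have "(\<lambda>z. \<psi> z * ((deriv ^^ n) f \<circ> \<phi>) z) has_fps_expansion
    fps_expansion \<psi> 0 * ((fps_deriv ^^ n) (fps_expansion f 0) oo fps_expansion \<phi> 0)"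
    by (intro has_fps_expansion_mult has_fps_expansion_compose ex \<phi> \<psi> \<Phi>0)
  then have "fps_expansion (weighted_comp_diff n \<psi> \<phi> f) 0 =
    fps_expansion \<psi> 0 * ((fps_deriv ^^ n) (fps_expansion f 0) oo fps_expansion \<phi> 0)"
    by (rule fps_expansion_eqI_on_disk) (simp add: weighted_comp_diff_def)
  then show ?thesis
    by (simp add: fps_nth_mult_compose[OF \<Phi>0] fps_nth_funpow_deriv)
qed

section \<open>Conjugations\<close>

lemma conjugation_disk_power:
  assumes "cmod \<eta> = 1"
  shows "conjugation \<mu> \<eta> (disk_power k) = disk_poly (monom (\<mu> * \<eta> ^ k) k)"
  using assms by (auto simp: conjugation_def disk_poly_def poly_monom fun_eq_iff norm_mult power_mult_distrib)

lemma taylor_coeff_conjugation: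
  assumes f: "f holomorphic_on unit_disk" and \<eta>: "cmod \<eta> = 1"
  shows "taylor_coeff (conjugation \<mu> \<eta> f) k = \<mu> * \<eta> ^ k * cnj (taylor_coeff f k)"
proof -
  have "conjugation \<mu> \<eta> f has_fps_expansion Abs_fps (\<lambda>k. \<mu> * \<eta> ^ k * cnj (taylor_coeff f k))"
  proof (rule has_fps_expansionI)
    have "eventually (\<lambda>z. z \<in> unit_disk) (nhds (0::complex))"
      by (intro eventually_nhds_in_open) auto
    then show "eventually (\<lambda>z. (\<lambda>k. fps_nth (Abs_fps (\<lambda>k. \<mu> * \<eta> ^ k * cnj (taylor_coeff f k))) k * z ^ k)
        sums conjugation \<mu> \<eta> f z) (nhds 0)"
    proof eventually_elim
      case (elim z)
      then have "(\<lambda>k. taylor_coeff f k * cnj (\<eta> * z) ^ k) sums f (cnj (\<eta> * z))"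
        using \<eta> by (intro taylor_sums[OF f]) (simp add: norm_mult)
      then have "(\<lambda>k. cnj (taylor_coeff f k * cnj (\<eta> * z) ^ k)) sums cnj (f (cnj (\<eta> * z)))"
        unfolding sums_cnj .
      then have "(\<lambda>k. \<mu> * cnj (taylor_coeff f k * cnj (\<eta> * z) ^ k)) sums (\<mu> * cnj (f (cnj (\<eta> * z))))"
        by (rule sums_mult)
      then show ?case
        by (simp add: conjugation_def power_mult_distrib mult_ac)
    qed
  qed
  from fps_expansion_eqI[OF this] show ?thesis by simp
qed

lemma conjugation_in_bergman_space:
  assumes f: "f \<in> bergman_space \<alpha>"
  shows "conjugation 1 1 f \<in> bergman_space \<alpha>"
proof -
  have J: "conjugation 1 1 f = cnj \<circ> f \<circ> cnj" by (auto simp: conjugation_def)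
  have "cnj ` unit_disk = unit_disk"
    by (auto simp: image_iff intro!: bexI[of _ "cnj _"])
  then have "cnj \<circ> f \<circ> cnj holomorphic_on unit_disk"
    using f by (intro holomorphic_on_compose_cnj_cnj) (auto simp: bergman_space_def)
  moreover have "integrable (bergman_measure \<alpha>) (\<lambda>z. (cmod ((cnj \<circ> f \<circ> cnj) z))\<^sup>2)"
  proof -
    have c: "cnj \<in> borel_measurable borel"
      by (intro borel_measurable_continuous_onI continuous_intros)
    have m: "(\<lambda>z. (cmod (f z))\<^sup>2) \<in> borel_measurable borel"
      using borel_measurable_bergman[OF f] by simp
    have "integrable (distr (bergman_measure \<alpha>) borel cnj) (\<lambda>z. (cmod (f z))\<^sup>2)"
      using f by (simp add: distr_bergman_measure c lborel_cnj bergman_space_def)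
    then show ?thesis
      using c m by (subst (asm) integrable_distr_eq) simp_all
  qed
  ultimately show ?thesis using f by (auto simp: bergman_space_def J)
qed

section \<open>Operators that are diagonal on Taylor coefficients\<close>

text \<open>Let \<open>J\<close> be the conjugation with both parameters 1, which conjugates Taylor coefficients. Then
  \<open>J T J\<close> multiplies the \<open>k\<close>-th coefficient by \<open>cnj (l k)\<close>, so it is the adjoint of \<open>T\<close>, and two
  coefficientwise multiplications commute. Writing the adjoint as \<open>J T J\<close> shows that it maps the
  space to itself.\<close>

lemma normal_if_diagonal:
  assumes \<alpha>: "\<alpha> > -1" and T: "bounded_operator \<alpha> T"
    and diag: "\<And>f k. f \<in> bergman_space \<alpha> \<Longrightarrow> taylor_coeff (T f) k = l k * taylor_coeff f k"
  shows "normal_operator \<alpha> T"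
proof -
  define S where "S g = conjugation 1 1 (T (conjugation 1 1 g))" for g
  have Tb: "T f \<in> bergman_space \<alpha>" if "f \<in> bergman_space \<alpha>" for f
    using T that by (simp add: bounded_operator_def)
  have Sb: "S g \<in> bergman_space \<alpha>" if "g \<in> bergman_space \<alpha>" for g
    unfolding S_def by (intro conjugation_in_bergman_space Tb that)
  have hol: "f holomorphic_on unit_disk" if "f \<in> bergman_space \<alpha>" for f
    using that by (simp add: bergman_space_def)
  have S: "taylor_coeff (S g) k = cnj (l k) * taylor_coeff g k" if "g \<in> bergman_space \<alpha>" for g k
    using that
    by (simp add: S_def taylor_coeff_conjugation hol Tb diag conjugation_in_bergman_space)
  have adj: "hilbert_adjoint \<alpha> T g = S g" if g: "g \<in> bergman_space \<alpha>" for g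
    by (intro hilbert_adjoint_eqI \<alpha> Sb g bergman_inner_eqI Tb) (simp_all add: diag S g)
  have "T (S f) = S (T f)" if f: "f \<in> bergman_space \<alpha>" for f
    by (rule bergman_space_eqI[of _ \<alpha>]) (use f in \<open>simp_all add: Tb Sb diag S\<close>)
  then show ?thesis using T by (auto simp: normal_operator_def adj Tb)
qed

section \<open>Complex symmetric operators are diagonal\<close>

theorem theorem2p3:
  fixes \<alpha> :: real and n :: nat and \<mu> \<eta> :: complex and \<phi> \<psi> :: "complex \<Rightarrow> complex"
  assumes "\<alpha> > -1"
    and "n \<ge> 1"
    and "cmod \<mu> = 1" and "cmod \<eta> = 1"
    and "\<phi> holomorphic_on unit_disk" and "\<phi> ` unit_disk \<subseteq> unit_disk" and "\<phi> 0 = 0"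
    and "\<psi> holomorphic_on unit_disk" and "\<exists>z\<in>unit_disk. \<psi> z \<noteq> 0"
    and "bounded_operator \<alpha> (weighted_comp_diff n \<psi> \<phi>)"
    and "complex_symmetric \<alpha> (conjugation \<mu> \<eta>) (weighted_comp_diff n \<psi> \<phi>)"
  shows "normal_operator \<alpha> (weighted_comp_diff n \<psi> \<phi>)"
proof -
  note \<alpha> = assms(1)
  define T where "T = weighted_comp_diff n \<psi> \<phi>"
  \<comment> \<open>Up to the weights \<open>\<gamma>\<close>, \<open>A l j\<close> is the matrix entry of \<open>T\<close> at the monomials \<open>l\<close> and \<open>j\<close>.\<close>
  define A where "A l j = taylor_coeff (T (disk_power l)) j" for l j
  define \<gamma> where "\<gamma> k = bergman_inner \<alpha> (disk_power k) (disk_power k)" for k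
  define W where "W m = fps_expansion \<psi> 0 * fps_expansion \<phi> 0 ^ m" for m
  have \<gamma>0: "\<gamma> k \<noteq> 0" for k
    unfolding \<gamma>_def by (rule bergman_inner_disk_power_nonzero[OF \<alpha>])
  have poly_space: "disk_poly p \<in> bergman_space \<alpha>" for p
    by (rule disk_poly_in_bergman_space[OF \<alpha>])
  have hol: "f holomorphic_on unit_disk" if "f \<in> bergman_space \<alpha>" for f
    using that by (simp add: bergman_space_def)
  have Tb: "T f \<in> bergman_space \<alpha>" if "f \<in> bergman_space \<alpha>" for f
    using assms(10) that by (simp add: bounded_operator_def T_def)
  have coeff_T: "taylor_coeff (T f) j
      = (\<Sum>m\<le>j. fact (m + n) / fact m * taylor_coeff f (m + n) * fps_nth (W m) j)"
    if "f \<in> bergman_space \<alpha>" for f j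
    unfolding T_def W_def by (rule taylor_coeff_weighted_comp_diff) (use assms hol that in auto)
  have \<Phi>0: "fps_nth (fps_expansion \<phi> 0) 0 = 0" using assms(7) by (simp add: fps_expansion_def)
  have A_low: "A l j = 0" if "l < n" for l j
    unfolding A_def coeff_T[OF poly_space] using that by (intro sum.neutral) auto
  have A_far: "A l j = 0" if "l > j + n" for l j
    unfolding A_def coeff_T[OF poly_space] using that by (intro sum.neutral) auto
  have A_add: "A (m + n) j = fact (m + n) / fact m * fps_nth (W m) j" for m j
  proof (cases "m \<le> j")
    case True
    have "A (m + n) j = (\<Sum>i\<le>j. if i = m then fact (m + n) / fact m * fps_nth (W m) j else 0)"
      unfolding A_def coeff_T[OF poly_space] by (intro sum.cong) auto
    with True show ?thesis by simp
  next
    case False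
    then have "fps_nth (W m) j = 0"
      unfolding W_def by (intro fps_nth_mult_power_eq_0[OF \<Phi>0, of 0]) auto
    with False show ?thesis by (simp add: A_far)
  qed
  have coeff_T': "taylor_coeff (T f) j = (\<Sum>m\<le>j. taylor_coeff f (m + n) * A (m + n) j)"
    if "f \<in> bergman_space \<alpha>" for f j
    unfolding coeff_T[OF that] A_add by (simp add: mult_ac)
  have coeff_T_all: "taylor_coeff (T f) j = (\<Sum>m\<le>j + n. taylor_coeff f m * A m j)"
    if "f \<in> bergman_space \<alpha>" for f j
  proof -
    have "(\<Sum>m\<le>j + n. taylor_coeff f m * A m j) = (\<Sum>m\<in>(\<lambda>m. m + n) ` {..j}. taylor_coeff f m * A m j)"
    proof (rule sum.mono_neutral_right)
      show "\<forall>m\<in>{..j + n} - (\<lambda>m. m + n) ` {..j}. taylor_coeff f m * A m j = 0"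
      proof
        fix m assume m: "m \<in> {..j + n} - (\<lambda>m. m + n) ` {..j}"
        have "m < n"
        proof (rule ccontr)
          assume "\<not> m < n"
          then have "m = (m - n) + n" "m - n \<le> j" using m by auto
          then show False using m by blast
        qed
        then show "taylor_coeff f m * A m j = 0" by (simp add: A_low)
      qed
    qed auto
    also have "\<dots> = (\<Sum>m\<le>j. taylor_coeff f (m + n) * A (m + n) j)"
      by (subst sum.reindex) auto
    finally show ?thesis using coeff_T'[OF that] by simp
  qed
  \<comment> \<open>Complex symmetry makes the zero pattern of the matrix symmetric. The adjoint at a multiple
      of a monomial is the polynomial \<open>p\<close> whose coefficients are forced by testing against
      monomials; the conjugation then carries it to \<open>T (disk_power j)\<close>.\<close>
  have symmetric: "A j m = 0 \<longleftrightarrow> A m j = 0" for j m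
  proof -
    define c where "c = \<mu> * \<eta> ^ j"
    have c: "c \<noteq> 0" using assms(3,4) by (auto simp: c_def)
    define a where "a m = c * cnj (A m j * \<gamma> j / \<gamma> m)" for m
    define p where "p = (\<Sum>m\<le>j + n. monom (a m) m)"
    have p: "coeff p m = (if m \<le> j + n then a m else 0)" for m
      unfolding p_def coeff_sum by (simp add: if_distrib sum.If_cases)
    have e: "conjugation \<mu> \<eta> (disk_power j) = disk_poly (monom c j)"
      unfolding c_def by (rule conjugation_disk_power[OF assms(4)])
    have "hilbert_adjoint \<alpha> T (disk_poly (monom c j)) = disk_poly p"
    proof (rule hilbert_adjoint_eqI[OF \<alpha> poly_space])
      fix f assume f: "f \<in> bergman_space \<alpha>"
      have "bergman_inner \<alpha> (T f) (disk_poly (monom c j)) = taylor_coeff (T f) j * cnj c * \<gamma> j"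
        using bergman_inner_finite[OF \<alpha> Tb[OF f] poly_space, of "{j}" "monom c j"] by (simp add: \<gamma>_def)
      also have "\<dots> = (\<Sum>m\<le>j + n. taylor_coeff f m * cnj (a m) * \<gamma> m)"
        unfolding coeff_T_all[OF f] sum_distrib_right using \<gamma>0 by (intro sum.cong) (auto simp: a_def)
      also have "\<dots> = bergman_inner \<alpha> f (disk_poly p)"
        using bergman_inner_finite[OF \<alpha> f poly_space, of "{..j + n}" p] by (simp add: p \<gamma>_def)
      finally show "bergman_inner \<alpha> (T f) (disk_poly (monom c j)) = bergman_inner \<alpha> f (disk_poly p)" .
    qed
    moreover have "T (disk_power j)
        = conjugation \<mu> \<eta> (hilbert_adjoint \<alpha> T (conjugation \<mu> \<eta> (disk_power j)))"
      using assms(11) poly_space[of "monom 1 j"] unfolding complex_symmetric_def T_def by blast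
    ultimately have "A j m = \<mu> * \<eta> ^ m * cnj (coeff p m)"
      unfolding A_def e by (simp add: taylor_coeff_conjugation[OF hol[OF poly_space] assms(4)])
    moreover have "\<mu> * \<eta> ^ m \<noteq> 0" using assms(3,4) by auto
    ultimately show ?thesis
      using c \<gamma>0 by (cases "m \<le> j + n") (auto simp: p a_def A_far)
  qed
  \<comment> \<open>\<open>T\<close> kills the monomials of degree below \<open>n\<close>; by symmetry nothing in its range has terms of
      degree below \<open>n\<close>. Applied to the monomial \<open>n\<close>, whose image is \<open>fact n\<close> times \<open>\<psi>\<close>, this says
      that \<open>\<psi>\<close> vanishes to order \<open>n\<close>.\<close>
  have \<Psi>: "fps_nth (fps_expansion \<psi> 0) i = 0" if "i < n" for i
  proof -
    have "A (0 + n) i = 0" using symmetric[of n i] A_low[OF that] by simp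
    then show ?thesis unfolding A_add by (simp add: W_def)
  qed
  \<comment> \<open>The image of the monomial \<open>m + n\<close> is a multiple of \<open>\<psi> \<phi>\<^sup>m\<close>, so it vanishes to order \<open>m + n\<close>.\<close>
  have lower: "A l j = 0" if "j < l" for j l
  proof (cases "l < n")
    case False
    then obtain m where l: "l = m + n" by (metis add.commute le_Suc_ex not_less)
    have "fps_nth (W m) j = 0"
      unfolding W_def using that l by (intro fps_nth_mult_power_eq_0[OF \<Phi>0, of n] \<Psi>) auto
    then show ?thesis by (simp add: l A_add)
  qed (rule A_low)
  have off_diagonal: "A l j = 0" if "l \<noteq> j" for l j
    using lower[of j l] lower[of l j] symmetric[of l j] that by linarith
  have diagonal: "taylor_coeff (T f) j = A j j * taylor_coeff f j" if "f \<in> bergman_space \<alpha>" for f j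
  proof -
    have "taylor_coeff (T f) j = (\<Sum>m\<le>j + n. if m = j then A j j * taylor_coeff f j else 0)"
      unfolding coeff_T_all[OF that] by (intro sum.cong) (auto simp: off_diagonal)
    then show ?thesis by simp
  qed
  have "bounded_operator \<alpha> T" using assms(10) by (simp add: T_def)
  from normal_if_diagonal[OF \<alpha> this diagonal] show ?thesis by (simp add: T_def)
qed

end
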